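(* If $G$ is a subcubic graph (i.e., a finite simple graph of maximum degree at most $3$), then \[ \nu_{ur}(G) \geq \frac{n(G) - c(G)}{2} - \frac{m(G)}{6}. \]
   Context: All graphs are simple, finite and undirected. A matching in $G$ is a set of pairwise non-adjacent edges. A matching $M$ in $G$ is uniquely restricted if no other matching in $G$ covers exactly the same set of vertices as $M$. $\nu_{ur}(G)$ denotes the maximum size of a uniquely restricted matching in $G$. $n(G)$, $m(G)$ and $c(G)$ denote the number of vertices, the number of edges, and the number of connected components of $G$, respectively. *)

theory Defs
  imports Complex_Main
begin

text \<open>A finite simple undirected graph is given by its vertex set \<open>V\<close> and its edge set \<open>E\<close>,
  an edge being the two-element set of its end vertices.\<close>

locale simple_graph =
  fixes V :: "'a set" and E :: "'a set set"
  assumes finite_verts: "finite V"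
    and edge_subset: "e \<in> E \<Longrightarrow> e \<subseteq> V"
    and edge_card: "e \<in> E \<Longrightarrow> card e = 2"

definition degree :: "'a set set \<Rightarrow> 'a \<Rightarrow> nat" where
  "degree E v = card {e \<in> E. v \<in> e}"

locale subcubic_graph = simple_graph +
  assumes degree_le_3: "v \<in> V \<Longrightarrow> degree E v \<le> 3"

definition matching :: "'a set set \<Rightarrow> 'a set set \<Rightarrow> bool" where
  "matching E M \<longleftrightarrow> M \<subseteq> E \<and> (\<forall>e\<in>M. \<forall>f\<in>M. e \<noteq> f \<longrightarrow> e \<inter> f = {})"

definition uniquely_restricted :: "'a set set \<Rightarrow> 'a set set \<Rightarrow> bool" where
  "uniquely_restricted E M \<longleftrightarrow>
     matching E M \<and> (\<forall>M'. matching E M' \<and> \<Union>M' = \<Union>M \<longrightarrow> M' = M)"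

definition nu_ur :: "'a set set \<Rightarrow> nat" where
  "nu_ur E = Max {card M | M. uniquely_restricted E M}"

definition connected_rel :: "'a set \<Rightarrow> 'a set set \<Rightarrow> ('a \<times> 'a) set" where
  "connected_rel V E = {(u, v) \<in> V \<times> V. (u, v) \<in> {(x, y). {x, y} \<in> E}\<^sup>*}"

definition components :: "'a set \<Rightarrow> 'a set set \<Rightarrow> 'a set set" where
  "components V E = V // connected_rel V E"

context simple_graph
begin

lemma finite_edges: "finite E"
  using finite_verts edge_subset by (meson PowI finite_Pow_iff finite_subset subsetI)

lemma uniquely_restricted_empty: "uniquely_restricted E {}"
proof -
  have "M = {}" if "M \<subseteq> E" "\<Union>M = {}" for M
  proof (rule ccontr)
    assume "M \<noteq> {}"
    then obtain e where "e \<in> M" by blast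
    with that have "e = {}" "card e = 2" using edge_card by auto
    then show False by simp
  qed
  then show ?thesis by (simp add: uniquely_restricted_def matching_def)
qed

text \<open>The maximum defining \<open>nu_ur\<close> is attained, and \<open>components\<close> is a partition of \<open>V\<close>:\<close>

lemma nu_ur_set_finite: "finite {card M | M. uniquely_restricted E M}"
proof -
  have "{card M | M. uniquely_restricted E M} \<subseteq> card ` Pow E"
    by (auto simp: uniquely_restricted_def matching_def)
  then show ?thesis using finite_edges by (meson finite_Pow_iff finite_imageI finite_subset)
qed

lemma nu_ur_set_nonempty: "{card M | M. uniquely_restricted E M} \<noteq> {}"
  using uniquely_restricted_empty by blast

lemma equiv_connected_rel: "equiv V (connected_rel V E)"
proof -
  have "sym {(x, y). {x, y} \<in> E}" by (auto simp: sym_def insert_commute)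
  then have "sym ({(x, y). {x, y} \<in> E}\<^sup>*)" by (rule sym_rtrancl)
  then show ?thesis
    unfolding equiv_def connected_rel_def
    by (auto simp: refl_on_def sym_def trans_def)
qed

end

end

theory Submission
  imports Defs
begin

text \<open>
  Write \<open>c\<close> for the number of components. Induct on the number of edges, keeping the vertex set
  fixed: if deleting a set \<open>F\<close> of edges raises \<open>c\<close> by \<open>d\<close> and lets us add \<open>t\<close> edges to the
  matching, the induction goes through as soon as \<open>3 d \<le> |F| + 6 t\<close>.
  All edges at a vertex may be deleted with \<open>t = 0\<close>, and all edges meeting the closed
  neighbourhood of a non-isolated vertex \<open>u\<close> may be deleted with \<open>t = 1\<close>, because then \<open>u\<close> can
  only be matched to the chosen partner. The following cases are exhaustive.

  If \<open>u\<close> has degree 1, then \<open>d \<le> |F| \<le> 3\<close>. If \<open>w\<close> has degree 3 and no edge at \<open>w\<close> is a bridge,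
  then deleting \<open>w\<close> gives \<open>d \<le> 1\<close> with \<open>|F| = 3\<close>. Otherwise take a smallest non-empty set \<open>K\<close>
  of non-isolated vertices that at most one edge leaves. By minimality no edge inside \<open>K\<close> is a
  bridge, so all vertices of \<open>K\<close> except possibly one have degree 2 (\<open>K\<close> spans a cycle), and some
  \<open>u \<in> K\<close> of degree 2 has \<open>|F| \<le> 4\<close>; as \<open>F\<close> contains an edge that is not a bridge, \<open>d \<le> 3\<close>.
\<close>

text \<open>Removing these edges stands for deleting the vertices in \<open>X\<close>, which stay
  behind as isolated vertices.\<close>

definition incident_edges :: "'a set set \<Rightarrow> 'a set \<Rightarrow> 'a set set" where
  "incident_edges E X = {e \<in> E. e \<inter> X \<noteq> {}}"

text \<open>The edge boundary of \<open>A\<close>. Here \<open>A\<close> ranges over all sets of the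
  type, so that complements \<open>- A\<close> are available.\<close>

definition cut_edges :: "'a set set \<Rightarrow> 'a set \<Rightarrow> 'a set set" where
  "cut_edges E A = {e \<in> E. e \<inter> A \<noteq> {} \<and> \<not> e \<subseteq> A}"

text \<open>Encoded as a one-element edge boundary, which avoids speaking of paths.\<close>

definition bridge :: "'a set set \<Rightarrow> 'a set \<Rightarrow> bool" where
  "bridge E e \<longleftrightarrow> (\<exists>A. cut_edges E A = {e})"

definition closed_nbhd :: "'a set set \<Rightarrow> 'a \<Rightarrow> 'a set" where
  \<comment> \<open>Empty if \<open>u\<close> is isolated.\<close>
  "closed_nbhd E u = \<Union>{e \<in> E. u \<in> e}"

lemma incident_edges_subset: "incident_edges E X \<subseteq> E"
  by (auto simp: incident_edges_def)

lemma degree_eq_card_incident_edges: "degree E v = card (incident_edges E {v})"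
  by (auto simp: degree_def incident_edges_def intro!: arg_cong[where f = card])


section \<open>Counting components\<close>

lemma (in simple_graph) edge_other_end:
  assumes "e \<in> E" "u \<in> e"
  obtains v where "e = {u, v}" "v \<noteq> u"
  using edge_card[OF assms(1)] assms(2) by (auto simp: card_2_iff)

lemma (in simple_graph) simple_graph_subset:
  "E' \<subseteq> E \<Longrightarrow> simple_graph V E'"
  using finite_verts edge_subset edge_card by unfold_locales auto

lemma (in subcubic_graph) subcubic_graph_subset:
  assumes "E' \<subseteq> E"
  shows "subcubic_graph V E'"
proof -
  interpret E': simple_graph V E' using assms by (rule simple_graph_subset)
  show ?thesis
  proof
    fix v assume "v \<in> V"
    have "degree E' v \<le> degree E v"
      unfolding degree_def using assms finite_edges by (intro card_mono) auto
    then show "degree E' v \<le> 3" using degree_le_3[OF \<open>v \<in> V\<close>] by simp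
  qed
qed

lemma (in simple_graph) finite_components: "finite (components V E)"
  unfolding components_def quotient_def using finite_verts by auto

lemma components_no_edges: "card (components V {}) = card V"
proof -
  have "components V {} = (\<lambda>x. {x}) ` V"
    by (auto simp: components_def connected_rel_def quotient_def)
  then show ?thesis by (simp add: card_image)
qed

lemma adjacency_rtrancl_sym:
  "(x, y) \<in> {(x, y). {x, y} \<in> E}\<^sup>* \<Longrightarrow> (y, x) \<in> {(x, y). {x, y} \<in> E}\<^sup>*"
proof -
  have "sym {(x, y). {x, y} \<in> E}" by (auto simp: sym_def insert_commute)
  then show "(x, y) \<in> {(x, y). {x, y} \<in> E}\<^sup>* \<Longrightarrow> (y, x) \<in> {(x, y). {x, y} \<in> E}\<^sup>*"
    by (meson sym_rtrancl symD)
qed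

text \<open>Every step along \<open>{a, b}\<close> can be replaced by the detour from
  \<open>a\<close> to \<open>b\<close>, so both reachability relations agree.\<close>

lemma components_delete_connected_edge:
  assumes ab: "(a, b) \<in> {(x, y). {x, y} \<in> E - {{a, b}}}\<^sup>*"
  shows "components V (E - {{a, b}}) = components V E"
proof -
  let ?R = "{(x, y). {x, y} \<in> E}" and ?R' = "{(x, y). {x, y} \<in> E - {{a, b}}}"
  have "?R \<subseteq> ?R'\<^sup>*"
  proof (clarify)
    fix x y assume "{x, y} \<in> E"
    show "(x, y) \<in> ?R'\<^sup>*"
    proof (cases "{x, y} = {a, b}")
      case True
      then have "x = a \<and> y = b \<or> x = b \<and> y = a" by (simp add: doubleton_eq_iff)
      then show ?thesis using ab adjacency_rtrancl_sym[OF ab] by metis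
    next
      case False
      then show ?thesis using \<open>{x, y} \<in> E\<close> by (intro r_into_rtrancl) simp
    qed
  qed
  then have "?R\<^sup>* \<subseteq> ?R'\<^sup>*" by (rule rtrancl_subset_rtrancl)
  moreover have "?R'\<^sup>* \<subseteq> ?R\<^sup>*" by (intro rtrancl_mono) auto
  ultimately have "?R'\<^sup>* = ?R\<^sup>*" by blast
  then show ?thesis by (simp add: components_def connected_rel_def)
qed

text \<open>If \<open>b\<close> were unreachable from \<open>a\<close> without \<open>e\<close>, the
  set reachable from \<open>a\<close> would have edge boundary \<open>{e}\<close>, making
  \<open>e\<close> a bridge.\<close>

lemma (in simple_graph) components_delete_nonbridge:
  assumes "e \<in> E" "\<not> bridge E e"
  shows "components V (E - {e}) = components V E"
proof -
  obtain a b where e: "e = {a, b}" using edge_card[OF assms(1)] by (meson card_2_iff)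
  let ?R' = "{(x, y). {x, y} \<in> E - {e}}"
  have "(a, b) \<in> ?R'\<^sup>*"
  proof (rule ccontr)
    assume nab: "(a, b) \<notin> ?R'\<^sup>*"
    define A where "A = {y. (a, y) \<in> ?R'\<^sup>*}"
    have "f = e" if f: "f \<in> cut_edges E A" for f
    proof (rule ccontr)
      assume "f \<noteq> e"
      from f obtain p q where pq: "p \<in> f" "p \<in> A" "q \<in> f" "q \<notin> A" and "f \<in> E"
        by (auto simp: cut_edges_def)
      then have "f = {p, q}" using edge_card[OF \<open>f \<in> E\<close>] by (auto simp: card_2_iff)
      then have "(p, q) \<in> ?R'" using \<open>f \<in> E\<close> \<open>f \<noteq> e\<close> by auto
      then show False using pq by (auto simp: A_def intro: rtrancl_into_rtrancl)
    qed
    moreover have "e \<in> cut_edges E A"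
      using assms(1) nab by (auto simp: cut_edges_def A_def e)
    ultimately have "cut_edges E A = {e}" by blast
    then show False using assms(2) by (auto simp: bridge_def)
  qed
  then show ?thesis unfolding e by (rule components_delete_connected_edge)
qed

text \<open>Only the component of \<open>a\<close> can break up, and its pieces are the new
  components of \<open>a\<close> and of \<open>b\<close>.\<close>

lemma (in simple_graph) card_components_delete_edge:
  assumes "e \<in> E"
  shows "card (components V (E - {e})) \<le> card (components V E) + 1"
proof -
  obtain a b where e: "e = {a, b}" using edge_card[OF assms(1)] by (meson card_2_iff)
  have abV: "a \<in> V" "b \<in> V" using edge_subset[OF assms] e by auto
  let ?R = "{(x, y). {x, y} \<in> E}" and ?R' = "{(x, y). {x, y} \<in> E - {e}}"
  let ?C = "\<lambda>x. connected_rel V E `` {x}" and ?C' = "\<lambda>x. connected_rel V (E - {e}) `` {x}"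
  interpret E': simple_graph V "E - {e}" by (rule simple_graph_subset) auto
  have sub: "?R'\<^sup>* \<subseteq> ?R\<^sup>*" by (intro rtrancl_mono) auto
  have "components V (E - {e}) \<subseteq> {?C' a, ?C' b} \<union> (components V E - {?C a})"
  proof
    fix Y assume "Y \<in> components V (E - {e})"
    then obtain x where x: "x \<in> V" and Y: "Y = ?C' x"
      by (auto simp: components_def quotient_def)
    show "Y \<in> {?C' a, ?C' b} \<union> (components V E - {?C a})"
    proof (cases "(x, a) \<in> ?R'\<^sup>* \<or> (x, b) \<in> ?R'\<^sup>*")
      case True
      then have "(x, a) \<in> connected_rel V (E - {e}) \<or> (x, b) \<in> connected_rel V (E - {e})"
        using x abV by (auto simp: connected_rel_def)
      then show ?thesis
        using equiv_class_eq[OF E'.equiv_connected_rel] Y by blast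
    next
      case False
      \<comment> \<open>Since \<open>x\<close> reaches neither end of \<open>e\<close> without using
        \<open>e\<close>, no walk from \<open>x\<close> ever uses \<open>e\<close>.\<close>
      have "(x, y) \<in> ?R'\<^sup>*" if "(x, y) \<in> ?R\<^sup>*" for y
        using that
      proof (induction rule: rtrancl_induct)
        case base
        show ?case by simp
      next
        case (step y z)
        then have "y \<noteq> a" "y \<noteq> b" using False by auto
        then have "(y, z) \<in> ?R'" using step.hyps(2) by (auto simp: e doubleton_eq_iff)
        with step.IH show ?case by (rule rtrancl_into_rtrancl)
      qed
      then have eq: "?C x = ?C' x"
        using sub x by (auto simp: connected_rel_def)
      have "a \<notin> ?C' x" using False by (auto simp: connected_rel_def)
      moreover have "a \<in> ?C a" using abV by (auto simp: connected_rel_def)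
      ultimately have "Y \<noteq> ?C a" using Y by auto
      moreover have "Y \<in> components V E"
        unfolding components_def Y eq[symmetric] using x by (rule quotientI)
      ultimately show ?thesis by blast
    qed
  qed
  then have "card (components V (E - {e})) \<le> card ({?C' a, ?C' b} \<union> (components V E - {?C a}))"
    by (rule card_mono[rotated]) (simp add: finite_components)
  also have "\<dots> \<le> card {?C' a, ?C' b} + card (components V E - {?C a})"
    by (rule card_Un_le)
  also have "\<dots> \<le> 2 + (card (components V E) - 1)"
  proof -
    have "?C a \<in> components V E" using abV by (auto simp: components_def intro: quotientI)
    then show ?thesis
      by (intro add_mono) (auto simp: card_insert_if)
  qed
  \<comment> \<open>The subtraction of 1 is not truncated, because the component of \<open>a\<close>
    exists.\<close>
  also have "\<dots> = card (components V E) + 1"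
  proof -
    have "?C a \<in> components V E" using abV by (auto simp: components_def intro: quotientI)
    then have "card (components V E) > 0" using finite_components by (auto simp: card_gt_0_iff)
    then show ?thesis by simp
  qed
  finally show ?thesis .
qed

lemma (in simple_graph) card_components_delete_edges:
  assumes "F \<subseteq> E"
  shows "card (components V (E - F)) \<le> card (components V E) + card F"
proof -
  have "finite F" using assms finite_edges by (rule finite_subset)
  then show ?thesis using assms
  proof (induction F)
    case empty
    then show ?case by simp
  next
    case (insert e F)
    interpret E': simple_graph V "E - F" by (rule simple_graph_subset) auto
    have "e \<in> E - F" using insert by auto
    from E'.card_components_delete_edge[OF this] insert show ?case
      by (simp add: Diff_insert[symmetric])
  qed
qed

text \<open>Deleting \<open>e\<close> first adds no component; each of the remaining
  \<open>card F - 1\<close> edges adds at most one.\<close>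

lemma (in simple_graph) card_components_delete_edges_nonbridge:
  assumes "F \<subseteq> E" "e \<in> F" "\<not> bridge E e"
  shows "card (components V (E - F)) + 1 \<le> card (components V E) + card F"
proof -
  interpret E': simple_graph V "E - {e}" by (rule simple_graph_subset) auto
  have "finite F" using assms(1) finite_edges by (rule finite_subset)
  have "card (components V (E - {e} - (F - {e})))
      \<le> card (components V (E - {e})) + card (F - {e})"
    using assms by (intro E'.card_components_delete_edges) auto
  moreover have "E - {e} - (F - {e}) = E - F" using assms(2) by auto
  moreover have "card F = card (F - {e}) + 1"
    using \<open>finite F\<close> assms(2) by (metis Suc_eq_plus1 card.remove)
  moreover have "components V (E - {e}) = components V E"
    using assms by (intro components_delete_nonbridge) auto
  ultimately show ?thesis by simp
qed

lemma cut_edges_Compl: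
  assumes "\<And>e. e \<in> E \<Longrightarrow> e \<noteq> {}"
  shows "cut_edges E (- A) = cut_edges E A"
  using assms by (auto simp: cut_edges_def)

text \<open>Once \<open>e1\<close> is gone, \<open>e2\<close> is still no bridge, since otherwise
  \<open>E\<close> would have a bridge at \<open>w\<close>. So among the three deletions only the
  last can add a component.\<close>

lemma (in simple_graph) card_components_delete_cubic_vertex:
  assumes deg: "degree E w = 3"
    and nb: "\<And>e. e \<in> E \<Longrightarrow> w \<in> e \<Longrightarrow> \<not> bridge E e"
  shows "card (components V (E - incident_edges E {w})) \<le> card (components V E) + 1"
proof -
  obtain e1 e2 e3 where star: "incident_edges E {w} = {e1, e2, e3}"
    and ne: "e1 \<noteq> e2" "e1 \<noteq> e3" "e2 \<noteq> e3"
    using deg unfolding degree_eq_card_incident_edges card_3_iff by blast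
  have mem: "e1 \<in> E" "e2 \<in> E" "e3 \<in> E" "w \<in> e1" "w \<in> e2" "w \<in> e3"
    using star by (auto simp: incident_edges_def)
  have star': "f \<in> {e1, e2, e3}" if "f \<in> E" "w \<in> f" for f
    using that star by (auto simp: incident_edges_def)
  interpret E': simple_graph V "E - {e1}" by (rule simple_graph_subset) auto
  have "\<not> bridge (E - {e1}) e2"
  proof
    assume "bridge (E - {e1}) e2"
    then obtain A0 where A0: "cut_edges (E - {e1}) A0 = {e2}" by (auto simp: bridge_def)
    have nonempty: "f \<noteq> {}" if "f \<in> E" for f using edge_card[OF that] by auto
    \<comment> \<open>Passing to the complement if necessary, \<open>A\<close> is the side that
      contains \<open>w\<close>.\<close>
    obtain A where A: "cut_edges (E - {e1}) A = {e2}" and "w \<in> A"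
    proof (cases "w \<in> A0")
      case False
      have "cut_edges (E - {e1}) (- A0) = {e2}"
        using A0 nonempty by (subst cut_edges_Compl) auto
      then show ?thesis using False that by blast
    qed (use A0 that in blast)
    have cutA: "f \<subseteq> A \<or> f \<inter> A = {}" if "f \<in> E" "f \<noteq> e1" "f \<noteq> e2" for f
      using A that by (auto simp: cut_edges_def)
    have e2A: "\<not> e2 \<subseteq> A" using A by (auto simp: cut_edges_def)
    have e1A: "\<not> e1 \<subseteq> A"
    proof
      assume "e1 \<subseteq> A"
      then have "cut_edges E A = cut_edges (E - {e1}) A" by (auto simp: cut_edges_def)
      then show False using A nb mem by (auto simp: bridge_def)
    qed
    have e3A: "e3 \<subseteq> A" using cutA[of e3] mem ne \<open>w \<in> A\<close> by auto
    have two: "f = {w, z}" if "f \<in> E" "w \<in> f" "z \<in> f" "z \<noteq> w" for f z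
      using edge_card[OF that(1)] that by (auto simp: card_2_iff)
    \<comment> \<open>\<open>A\<close> is cut off by \<open>e1\<close> and \<open>e2\<close>, so removing \<open>w\<close> from it leaves the cut \<open>{e3}\<close>.\<close>
    have "cut_edges E (A - {w}) = {e3}"
    proof (intro equalityI subsetI)
      fix f assume f: "f \<in> cut_edges E (A - {w})"
      then obtain z where z: "z \<in> f" "z \<in> A" "z \<noteq> w" and fE: "f \<in> E"
        by (auto simp: cut_edges_def)
      show "f \<in> {e3}"
      proof (cases "w \<in> f")
        case True
        then have "f = {w, z}" using two fE z by auto
        then have "f \<subseteq> A" using z \<open>w \<in> A\<close> by auto
        then show ?thesis using star'[OF fE True] e1A e2A by auto
      next
        case False
        then have "f \<noteq> e1" "f \<noteq> e2" using mem by auto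
        then have "f \<subseteq> A" using cutA[OF fE] z by auto
        then show ?thesis using f False by (auto simp: cut_edges_def)
      qed
    next
      fix f assume "f \<in> {e3}"
      moreover have "e3 \<noteq> {w}" using edge_card[OF mem(3)] by auto
      then obtain z where "z \<in> e3" "z \<noteq> w" using mem by blast
      ultimately show "f \<in> cut_edges E (A - {w})"
        using mem e3A by (auto simp: cut_edges_def)
    qed
    then show False using nb mem by (auto simp: bridge_def)
  qed
  then have "card (components V (E - {e1} - {e2, e3})) + 1
      \<le> card (components V (E - {e1})) + card {e2, e3}"
    using mem ne by (intro E'.card_components_delete_edges_nonbridge) auto
  moreover have "components V (E - {e1}) = components V E"
    using mem nb by (intro components_delete_nonbridge) auto
  moreover have "E - {e1} - {e2, e3} = E - incident_edges E {w}" using star by auto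
  ultimately show ?thesis using ne by simp
qed


section \<open>Extending uniquely restricted matchings\<close>

text \<open>A matching that covers the same vertices as \<open>M\<close> also misses
  \<open>X\<close>, so it already lives in the smaller graph.\<close>

lemma uniquely_restricted_delete_vertices:
  assumes "uniquely_restricted (E - incident_edges E X) M"
  shows "uniquely_restricted E M"
  unfolding uniquely_restricted_def
proof (intro conjI allI impI)
  have M: "matching (E - incident_edges E X) M"
    and uniq: "\<And>M'. matching (E - incident_edges E X) M' \<Longrightarrow> \<Union>M' = \<Union>M \<Longrightarrow> M' = M"
    using assms by (auto simp: uniquely_restricted_def)
  show "matching E M" using M by (auto simp: matching_def)
  fix M' assume "matching E M' \<and> \<Union>M' = \<Union>M"
  then have M': "matching E M'" and cov: "\<Union>M' = \<Union>M" by auto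
  have "\<Union>M \<inter> X = {}" using M by (auto simp: matching_def incident_edges_def)
  then have "f \<notin> incident_edges E X" if "f \<in> M'" for f
    using that cov unfolding incident_edges_def by blast
  then have "matching (E - incident_edges E X) M'"
    using M' by (simp add: matching_def subset_iff)
  then show "M' = M" using cov by (rule uniq)
qed

text \<open>A rival matching covers \<open>u\<close> by an edge \<open>f\<close> inside the closed
  neighbourhood, where only the ends of \<open>e\<close> are covered. Hence \<open>f = e\<close>,
  and removing \<open>e\<close> leaves a rival of \<open>M\<close>.\<close>

lemma (in simple_graph) uniquely_restricted_insert:
  assumes M: "uniquely_restricted (E - incident_edges E (closed_nbhd E u)) M"
    and e: "e \<in> E" "u \<in> e"
  shows "uniquely_restricted E (insert e M)" "e \<notin> M"
proof -
  let ?X = "closed_nbhd E u"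
  let ?E' = "E - incident_edges E ?X"
  have MM: "matching ?E' M"
    and uniq: "\<And>M'. matching ?E' M' \<Longrightarrow> \<Union>M' = \<Union>M \<Longrightarrow> M' = M"
    using M by (auto simp: uniquely_restricted_def)
  have disj: "\<Union>M \<inter> ?X = {}" using MM by (auto simp: matching_def incident_edges_def)
  have eX: "e \<subseteq> ?X" using e by (auto simp: closed_nbhd_def)
  show "e \<notin> M" using disj eX e by auto
  have me: "matching E (insert e M)"
    using MM disj eX e unfolding matching_def by (auto; blast)
  show "uniquely_restricted E (insert e M)"
    unfolding uniquely_restricted_def
  proof (intro conjI allI impI me)
    fix M' assume "matching E M' \<and> \<Union>M' = \<Union>(insert e M)"
    then have M': "matching E M'" and cov: "\<Union>M' = e \<union> \<Union>M" by auto
    from cov e obtain f where f: "f \<in> M'" "u \<in> f" by blast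
    have fE: "f \<in> E" using f M' by (auto simp: matching_def)
    have "f \<subseteq> ?X" using f fE by (auto simp: closed_nbhd_def)
    then have "f \<subseteq> e" using f cov disj by blast
    then have "f = e"
      using edge_card[OF e(1)] edge_card[OF fE]
      by (metis card.infinite card_subset_eq zero_neq_numeral)
    then have eM': "e \<in> M'" using f by simp
    have "\<Union>(M' - {e}) = \<Union>M' - e"
      using M' eM' unfolding matching_def by blast
    also have "\<dots> = \<Union>M" using cov disj eX by blast
    finally have cov': "\<Union>(M' - {e}) = \<Union>M" .
    have "f \<notin> incident_edges E ?X" if "f \<in> M' - {e}" for f
    proof -
      have "f \<subseteq> \<Union>M" using that cov' by blast
      then show ?thesis using disj unfolding incident_edges_def by blast
    qed
    then have "matching ?E' (M' - {e})"
      using M' unfolding matching_def by blast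
    then have "M' - {e} = M" using uniq cov' by blast
    then show "M' = insert e M" using eM' by auto
  qed
qed


section \<open>A reducible configuration\<close>

text \<open>A bridge \<open>e\<close> with side \<open>A\<close> would split \<open>K\<close> into
  \<open>K \<inter> A\<close> and \<open>K - A\<close>. Any other edge leaving a part also leaves
  \<open>K\<close>, and the at most one such edge leaves only one part. The boundary of the other
  part is then at most \<open>{e}\<close>, against minimality.\<close>

lemma (in simple_graph) nonbridge_inside_minimal:
  assumes K: "card (cut_edges E K) \<le> 1"
    and minimal: "\<And>L. L \<noteq> {} \<Longrightarrow> L \<subset> K \<Longrightarrow> 1 < card (cut_edges E L)"
    and e: "e \<in> E" "e \<subseteq> K"
  shows "\<not> bridge E e"
proof
  assume "bridge E e"
  then obtain A where A: "cut_edges E A = {e}" by (auto simp: bridge_def)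
  have fin: "finite (cut_edges E L)" for L
    using finite_edges by (auto simp: cut_edges_def)
  have eA: "e \<inter> A \<noteq> {}" "\<not> e \<subseteq> A" using A by (auto simp: cut_edges_def)
  have cutA: "f = e" if "f \<in> E" "p \<in> f" "p \<in> A" "q \<in> f" "q \<notin> A" for f p q
    using A that unfolding cut_edges_def by blast
  have sub: "cut_edges E (K \<inter> A) \<subseteq> insert e (cut_edges E K)"
      "cut_edges E (K - A) \<subseteq> insert e (cut_edges E K)"
    using cutA unfolding cut_edges_def by blast+
  have both: "f = e" if "f \<in> cut_edges E (K \<inter> A)" "f \<in> cut_edges E (K - A)" for f
    using that cutA unfolding cut_edges_def by blast
  have "cut_edges E (K \<inter> A) \<subseteq> {e} \<or> cut_edges E (K - A) \<subseteq> {e}"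
  proof (rule ccontr)
    assume "\<not> ?thesis"
    then obtain f g where f: "f \<in> cut_edges E (K \<inter> A)" "f \<noteq> e"
      and g: "g \<in> cut_edges E (K - A)" "g \<noteq> e" by blast
    then have "f \<in> cut_edges E K" "g \<in> cut_edges E K" using sub by auto
    then have "f = g" using K fin by (metis One_nat_def card_le_Suc0_iff_eq)
    then show False using f g both by auto
  qed
  then have "card (cut_edges E (K \<inter> A)) \<le> 1 \<or> card (cut_edges E (K - A)) \<le> 1"
    by (metis card.empty card_1_singleton_iff One_nat_def le_refl subset_singletonD zero_le)
  moreover have "K \<inter> A \<noteq> {}" "K \<inter> A \<subset> K" "K - A \<noteq> {}" "K - A \<subset> K"
    using eA e by auto
  ultimately show False using minimal by (meson leD)
qed

lemma (in subcubic_graph) exists_reducible_vertex: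
  assumes "E \<noteq> {}"
    and no_leaf: "\<And>v. degree E v \<noteq> 1"
    and cubic: "\<And>w. degree E w = 3 \<Longrightarrow> \<exists>e\<in>E. w \<in> e \<and> bridge E e"
  obtains u e where "e \<in> E" "u \<in> e" "\<not> bridge E e"
    "card (incident_edges E (closed_nbhd E u)) \<le> 4"
proof -
  note reducible = that
  \<comment> \<open>Staying inside \<open>\<Union>E\<close> keeps isolated vertices from being
    trivial minimal sets; \<open>\<Union>E\<close> itself qualifies, as no edge leaves it.\<close>
  let ?P = "\<lambda>K. K \<noteq> {} \<and> K \<subseteq> \<Union>E \<and> card (cut_edges E K) \<le> 1"
  have finU: "finite (\<Union>E)" using finite_verts edge_subset by (meson Sup_least finite_subset)
  have fin: "finite {f \<in> E. Q f}" for Q using finite_edges by auto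
  have "\<exists>e\<in>E. e \<noteq> {}" using assms(1) edge_card by fastforce
  moreover have "cut_edges E (\<Union>E) = {}" by (auto simp: cut_edges_def)
  ultimately have "?P (\<Union>E)" by auto
  then obtain K where PK: "?P K" and min: "\<And>L. ?P L \<Longrightarrow> card K \<le> card L"
    using ex_has_least_nat[of ?P "\<Union>E" card] by blast
  have finK: "finite K" using PK finU finite_subset by auto
  have minimal: "1 < card (cut_edges E L)" if "L \<noteq> {}" "L \<subset> K" for L
  proof (rule ccontr)
    assume "\<not> ?thesis"
    then have "?P L" using that PK by auto
    then have "card K \<le> card L" by (rule min)
    then show False using psubset_card_mono[OF finK that(2)] by simp
  qed
  have inside: "\<not> bridge E e" if "e \<in> E" "e \<subseteq> K" for e
    using nonbridge_inside_minimal[of K e] PK minimal that by blast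
  have KU: "K \<subseteq> \<Union>E" using PK by blast
  have deg_ge: "2 \<le> degree E v" if vK: "v \<in> K" for v
  proof -
    obtain e where "e \<in> E" "v \<in> e" using vK KU by blast
    then have "degree E v \<noteq> 0" using fin by (auto simp: degree_def)
    then show ?thesis using no_leaf[of v] by linarith
  qed
  have deg_le: "degree E v \<le> 3" if "v \<in> K" for v
    using that KU edge_subset by (intro degree_le_3) blast
  have within: "e \<subseteq> K" if "v \<in> K" "v \<notin> \<Union>(cut_edges E K)" "e \<in> E" "v \<in> e" for v e
    using that by (auto simp: cut_edges_def)
  \<comment> \<open>All edges at such a vertex lie inside \<open>K\<close>, so none is a bridge and
    \<open>cubic\<close> excludes degree 3.\<close>
  have deg2: "degree E v = 2" if v: "v \<in> K" "v \<notin> \<Union>(cut_edges E K)" for v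
  proof -
    have "degree E v \<noteq> 3"
      using cubic[of v] within[OF v] inside by blast
    then show ?thesis using deg_ge deg_le v by force
  qed
  have two_nbrs: "\<exists>v w. v \<noteq> w \<and> v \<noteq> u \<and> w \<noteq> u \<and> incident_edges E {u} = {{u, v}, {u, w}}"
    if u: "degree E u = 2" for u
  proof -
    obtain e f where ef: "incident_edges E {u} = {e, f}" "e \<noteq> f"
      using u unfolding degree_eq_card_incident_edges card_2_iff by blast
    then have "e \<in> E" "f \<in> E" "u \<in> e" "u \<in> f" by (auto simp: incident_edges_def)
    then obtain v w where "e = {u, v}" "v \<noteq> u" "f = {u, w}" "w \<noteq> u"
      by (meson edge_other_end)
    then show ?thesis using ef by blast
  qed
  \<comment> \<open>The edges at \<open>u\<close> lie inside \<open>K\<close>, so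
    \<open>{u, v}\<close> serves as the non-bridge and only the count \<open>F\<close> is left to
    check.\<close>
  have conclude: thesis
    if u: "u \<in> K" "u \<notin> \<Union>(cut_edges E K)"
      and vw: "v \<noteq> w" "incident_edges E {u} = {{u, v}, {u, w}}"
      and F: "card (incident_edges E {u, v, w}) \<le> 4" for u v w
  proof -
    have "{e \<in> E. u \<in> e} = {{u, v}, {u, w}}"
      using vw by (auto simp: incident_edges_def)
    then have "closed_nbhd E u = {u, v, w}" by (auto simp: closed_nbhd_def)
    moreover have "{u, v} \<in> E" using vw by (auto simp: incident_edges_def)
    moreover from this have "\<not> bridge E {u, v}" using within[OF u] inside by blast
    ultimately show thesis using F by (intro reducible[of "{u, v}" u]) simp_all
  qed
  have split3: "incident_edges E {u, v, w}
      = incident_edges E {u} \<union> incident_edges E {v} \<union> incident_edges E {w}" for u v w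
    by (auto simp: incident_edges_def)
  \<comment> \<open>Both neighbours of \<open>u\<close> have degree 2, and the edges at
    \<open>u\<close> are already counted at \<open>v\<close> and \<open>w\<close>, whence at most 2
    + 2 edges.\<close>
  have path: thesis
    if u: "u \<in> K" "u \<notin> \<Union>(cut_edges E K)"
      and nb: "\<And>v. {u, v} \<in> E \<Longrightarrow> v \<notin> \<Union>(cut_edges E K)" for u
  proof -
    obtain v w where vw: "v \<noteq> w" "v \<noteq> u" "w \<noteq> u" "incident_edges E {u} = {{u, v}, {u, w}}"
      using two_nbrs[OF deg2[OF u]] by blast
    then have E: "{u, v} \<in> E" "{u, w} \<in> E" by (auto simp: incident_edges_def)
    then have "v \<in> K" "w \<in> K" using within[OF u] by blast+
    then have d: "degree E v = 2" "degree E w = 2" using deg2 nb E by blast+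
    have "incident_edges E {u, v, w} = incident_edges E {v} \<union> incident_edges E {w}"
      using vw E unfolding split3 by (auto simp: incident_edges_def)
    then have "card (incident_edges E {u, v, w}) \<le> 2 + 2"
      using card_Un_le[of "incident_edges E {v}" "incident_edges E {w}"] d
      by (simp add: degree_eq_card_incident_edges)
    then show thesis using conclude[OF u vw(1,4)] by simp
  qed
  show thesis
  proof (cases "cut_edges E K = {}")
    case True
    moreover obtain u where "u \<in> K" using PK by blast
    ultimately show thesis by (intro path[of u]) simp_all
  next
    case False
    have fc: "finite (cut_edges E K)" using fin by (auto simp: cut_edges_def)
    then have "card (cut_edges E K) = 1" using False PK by (metis card_0_eq le_neq_implies_less less_one)
    then obtain g where g: "cut_edges E K = {g}" by (rule card_1_singletonE)
    then have gE: "g \<in> E" and "g \<inter> K \<noteq> {}" "\<not> g \<subseteq> K" by (auto simp: cut_edges_def)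
    then obtain x where xK: "x \<in> K" and "x \<in> g" by blast
    then obtain y where gxy: "g = {x, y}" using edge_other_end[OF gE] by blast
    then have yK: "y \<notin> K" using xK \<open>\<not> g \<subseteq> K\<close> by blast
    have notcut: "v \<notin> \<Union>(cut_edges E K)" if "v \<in> K" "v \<noteq> x" for v
      using that g gxy yK by auto
    \<comment> \<open>The leaving edge touches \<open>K\<close> only in \<open>x\<close>, so
      \<open>path\<close> applies to any other vertex of \<open>K\<close> not adjacent to
      \<open>x\<close>. If there is none, \<open>x\<close> lies on a triangle in
      \<open>K\<close>.\<close>
    show thesis
    proof (cases "\<exists>u\<in>K. u \<noteq> x \<and> {u, x} \<notin> E")
      case True
      then obtain u where u: "u \<in> K" "u \<noteq> x" "{u, x} \<notin> E" by blast
      show thesis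
      proof (rule path[OF u(1) notcut[OF u(1,2)]])
        fix v assume v: "{u, v} \<in> E"
        then have "v \<in> K" using within[OF u(1) notcut[OF u(1,2)] v] by blast
        then show "v \<notin> \<Union>(cut_edges E K)" using v u notcut by blast
      qed
    next
      case False
      \<comment> \<open>Degree at least 2 gives \<open>x\<close> an edge \<open>h\<close> other than
        \<open>g\<close>, and \<open>h\<close> stays inside \<open>K\<close>.\<close>
      have "incident_edges E {x} \<noteq> {g}"
        using deg_ge[OF xK] by (auto simp: degree_eq_card_incident_edges)
      moreover have "g \<in> incident_edges E {x}" using gE gxy by (auto simp: incident_edges_def)
      ultimately obtain h where h: "h \<in> E" "x \<in> h" "h \<noteq> g" by (auto simp: incident_edges_def)
      then have "h \<subseteq> K" using g xK by (auto simp: cut_edges_def)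
      then obtain p where p: "h = {x, p}" "p \<in> K" "p \<noteq> x"
        using edge_other_end[OF h(1,2)] by blast
      note pc = notcut[OF p(2,3)]
      obtain v w where vw: "v \<noteq> w" "v \<noteq> p" "w \<noteq> p" "incident_edges E {p} = {{p, v}, {p, w}}"
        using two_nbrs[OF deg2[OF p(2) pc]] by blast
      have "h \<in> incident_edges E {p}" using h p by (auto simp: incident_edges_def)
      then have "x = v \<or> x = w" using vw p by (auto simp: doubleton_eq_iff)
      then obtain q where q: "q \<noteq> x" "q \<noteq> p" "incident_edges E {p} = {{p, x}, {p, q}}"
        using vw insert_commute[of "{p, v}" "{p, w}"] by (metis (no_types))
      then have pqE: "{p, q} \<in> E" by (auto simp: incident_edges_def)
      then have qK: "q \<in> K" using within[OF p(2) pc] by blast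
      then have qxE: "{q, x} \<in> E" using False q by blast
      have "degree E q = 2" using deg2[OF qK notcut[OF qK q(1)]] .
      moreover have "{{q, x}, {p, q}} \<subseteq> incident_edges E {q}"
        using qxE pqE by (auto simp: incident_edges_def)
      moreover have "card {{q, x}, {p, q}} = 2"
        using p q by (auto simp: doubleton_eq_iff card_insert_if)
      moreover have "finite (incident_edges E {q})" using fin by (auto simp: incident_edges_def)
      ultimately have qstar: "incident_edges E {q} = {{q, x}, {p, q}}"
        unfolding degree_eq_card_incident_edges by (metis card_subset_eq)
      \<comment> \<open>The triangle on \<open>p\<close>, \<open>x\<close>, \<open>q\<close> meets
        only the at most three edges at \<open>x\<close> and the edge \<open>{p, q}\<close>.\<close>
      have "{p, x} \<in> E" using q by (auto simp: incident_edges_def)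
      then have "incident_edges E {p, x, q} = insert {p, q} (incident_edges E {x})"
        using qxE pqE unfolding split3 q(3) qstar by (auto simp: incident_edges_def)
      moreover have "card (incident_edges E {x}) \<le> 3"
        using deg_le[OF xK] by (simp add: degree_eq_card_incident_edges)
      moreover have "card (insert {p, q} (incident_edges E {x})) \<le> Suc (card (incident_edges E {x}))"
        by (rule card_insert_le_m1) simp_all
      ultimately have "card (incident_edges E {p, x, q}) \<le> 4" by simp
      then show thesis using conclude[OF p(2) pc q(1)[symmetric] q(3)] by simp
    qed
  qed
qed

text \<open>The only edge at \<open>u\<close> ends at its neighbour \<open>v\<close>, so the edges
  to be deleted are just the at most three at \<open>v\<close>.\<close>

lemma (in subcubic_graph) leaf_incident_edges:
  assumes "degree E u = 1"
  obtains e where "e \<in> E" "u \<in> e" "card (incident_edges E (closed_nbhd E u)) \<le> 3"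
proof -
  obtain e where star: "incident_edges E {u} = {e}"
    using assms unfolding degree_eq_card_incident_edges by (rule card_1_singletonE)
  then have e: "e \<in> E" "u \<in> e" by (auto simp: incident_edges_def)
  then obtain v where v: "e = {u, v}" using edge_card[OF e(1)] by (auto simp: card_2_iff)
  have "{f \<in> E. u \<in> f} = {e}" using star by (auto simp: incident_edges_def)
  then have "closed_nbhd E u = {u, v}" by (simp add: closed_nbhd_def v)
  moreover have "incident_edges E {u, v} = incident_edges E {v}"
    using star v by (auto simp: incident_edges_def)
  moreover have "degree E v \<le> 3" using edge_subset[OF e(1)] v by (intro degree_le_3) auto
  ultimately have "card (incident_edges E (closed_nbhd E u)) \<le> 3"
    by (simp add: degree_eq_card_incident_edges)
  with e that show thesis by blast
qed

section \<open>The induction on the number of edges\<close>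

text \<open>The bound is scaled by 6 and rearranged so that no subtraction of natural numbers
  occurs.\<close>

lemma exists_large_uniquely_restricted:
  assumes "subcubic_graph V E"
  shows "\<exists>M. uniquely_restricted E M \<and>
    3 * card V \<le> 6 * card M + card E + 3 * card (components V E)"
  using assms
proof (induction "card E" arbitrary: E rule: less_induct)
  case less
  interpret subcubic_graph V E by (rule less.prems)
  have card_del: "card E = card (E - F) + card F" if "F \<subseteq> E" for F
    using that finite_edges by (metis add.commute card_Diff_subset card_mono finite_subset le_add_diff_inverse)
  have IH: "\<exists>M. uniquely_restricted (E - F) M \<and>
      3 * card V \<le> 6 * card M + card (E - F) + 3 * card (components V (E - F))"
    if "F \<subseteq> E" "F \<noteq> {}" for F
  proof (rule less.hyps)
    show "card (E - F) < card E"
      using that finite_edges by (intro psubset_card_mono) auto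
    show "subcubic_graph V (E - F)" by (rule subcubic_graph_subset) auto
  qed
  \<comment> \<open>Premise \<open>c\<close> says that the new components are paid for by the
    deleted edges and the 6 gained from one more matching edge.\<close>
  have extend: ?case
    if e: "e \<in> E" "u \<in> e" and F: "F = incident_edges E (closed_nbhd E u)"
      and c: "3 * card (components V (E - F)) \<le> 3 * card (components V E) + card F + 6" for e u F
  proof -
    have sub: "F \<subseteq> E" unfolding F by (rule incident_edges_subset)
    have "e \<in> F" using e by (auto simp: F incident_edges_def closed_nbhd_def)
    then obtain M where M: "uniquely_restricted (E - F) M"
      and le: "3 * card V \<le> 6 * card M + card (E - F) + 3 * card (components V (E - F))"
      using IH[OF sub] by blast
    note ins = uniquely_restricted_insert[OF M[unfolded F] e]
    have "finite M" using ins(1) finite_edges finite_subset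
      unfolding uniquely_restricted_def matching_def by (metis finite_insert)
    then have "card (insert e M) = card M + 1" using ins(2) by simp
    then have "3 * card V \<le> 6 * card (insert e M) + card E + 3 * card (components V E)"
      using le c card_del[OF sub] by linarith
    then show ?case using ins(1) by blast
  qed
  consider "E = {}" | u where "degree E u = 1"
    | w where "degree E w = 3" "\<And>e. e \<in> E \<Longrightarrow> w \<in> e \<Longrightarrow> \<not> bridge E e"
    | "E \<noteq> {}" "\<And>v. degree E v \<noteq> 1" "\<And>w. degree E w = 3 \<Longrightarrow> \<exists>e\<in>E. w \<in> e \<and> bridge E e"
    by blast
  then show ?case
  proof cases
    \<comment> \<open>Without edges every vertex is its own component, and the empty matching gives
      equality.\<close>
    case 1
    then show ?thesis using uniquely_restricted_empty components_no_edges[of V]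
      by (intro exI[of _ "{}"]) simp
  next
    case 2
    obtain e where e: "e \<in> E" "u \<in> e" and F: "card (incident_edges E (closed_nbhd E u)) \<le> 3"
      using leaf_incident_edges[OF 2] .
    \<comment> \<open>At most \<open>|F|\<close> new components arise, and
      \<open>3 |F| \<le> |F| + 6\<close> because \<open>|F| \<le> 3\<close>.\<close>
    show ?thesis
      using card_components_delete_edges[OF incident_edges_subset, of "closed_nbhd E u"] F
      by (intro extend[OF e refl]) linarith
  next
    case 3
    let ?F = "incident_edges E {w}"
    have F: "card ?F = 3" using 3(1) by (simp add: degree_eq_card_incident_edges)
    then have "?F \<noteq> {}" by auto
    then obtain M where M: "uniquely_restricted (E - ?F) M"
      and le: "3 * card V \<le> 6 * card M + card (E - ?F) + 3 * card (components V (E - ?F))"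
      using IH[OF incident_edges_subset] by blast
    \<comment> \<open>The matching gains nothing, but the three deleted edges pay for the at most
      one new component.\<close>
    have "3 * card V \<le> 6 * card M + card E + 3 * card (components V E)"
      using le F card_components_delete_cubic_vertex[OF 3]
        card_del[OF incident_edges_subset, of "{w}"] by linarith
    then show ?thesis using uniquely_restricted_delete_vertices[OF M] by blast
  next
    case 4
    obtain u e where e: "e \<in> E" "u \<in> e" and nb: "\<not> bridge E e"
      and F: "card (incident_edges E (closed_nbhd E u)) \<le> 4"
      using exists_reducible_vertex[OF 4] by blast
    have "e \<in> incident_edges E (closed_nbhd E u)"
      using e by (auto simp: incident_edges_def closed_nbhd_def)
    \<comment> \<open>The non-bridge limits the new components to \<open>|F| - 1\<close>, and
      \<open>3 (|F| - 1) \<le> |F| + 6\<close> because \<open>|F| \<le> 4\<close>.\<close>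
    from card_components_delete_edges_nonbridge[OF incident_edges_subset this nb] F
    show ?thesis by (intro extend[OF e refl]) linarith
  qed
qed

theorem theorem2:
  fixes V :: "'a set" and E :: "'a set set"
  assumes "subcubic_graph V E"
  shows "real (nu_ur E) \<ge>
    (real (card V) - real (card (components V E))) / 2 - real (card E) / 6"
proof -
  interpret subcubic_graph V E by (rule assms)
  obtain M where M: "uniquely_restricted E M"
    and le: "3 * card V \<le> 6 * card M + card E + 3 * card (components V E)"
    using exists_large_uniquely_restricted[OF assms] by blast
  have "card M \<le> nu_ur E"
    unfolding nu_ur_def using M by (intro Max_ge[OF nu_ur_set_finite]) blast
  with le have "3 * card V \<le> 6 * nu_ur E + card E + 3 * card (components V E)" by linarith
  \<comment> \<open>Folding the casts outwards reduces this to the inequality over the natural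
    numbers.\<close>
  then have "3 * real (card V)
      \<le> 6 * real (nu_ur E) + real (card E) + 3 * real (card (components V E))"
    unfolding of_nat_numeral[symmetric, where 'a = real] of_nat_mult[symmetric]
      of_nat_add[symmetric] of_nat_le_iff .
  then show ?thesis by (simp add: field_simps)
qed

end
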